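(* Let $\varepsilon>0$. The BBMH system $$u_t+uu_x+v_x=0,\qquad v_t+\frac{1}{\varepsilon^2}u_x=\frac{1}{\varepsilon^2}w,\qquad w_t+\varepsilon^2w_x=-v,$$ for $q=(u,v,w)^T$ is a Hamiltonian PDE, i.e. it can be written as $$\partial_t q=\mathcal J\,\delta\mathcal H(q),$$ with relative equilibrium structure $$-\partial_x q=\mathcal J\,\delta\mathcal I(q),$$ where $$\mathcal J=-\operatorname{diag}\Bigl(\partial_x,\ \frac1{\varepsilon^2}\partial_x,\ \partial_x\Bigr),\qquad \mathcal H(q)=\int_{x_{\min}}^{x_{\max}}\Bigl(\frac{u^3}{6}+uv-v\chi+\varepsilon^2\frac{w^2}{2}\Bigr)\,dx,$$ $$\mathcal I(q)=\int_{x_{\min}}^{x_{\max}}\Bigl(\frac{u^2}{2}+\varepsilon^2\frac{v^2}{2}+\frac{w^2}{2}\Bigr)\,dx,$$ and $\chi$ is a potential of $w$, i.e. $\chi_x=w$.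
   Context: All functions are smooth and periodic in $x$ on $[x_{\min},x_{\max}]$. The components $v$ and $w$ are derivatives of periodic potentials, $v=\psi_x$ and $w=\chi_x$ (in particular they have zero mean). $\delta$ denotes the variational derivative with respect to $q=(u,v,w)$ and the $L^2$ inner product; in the $v$ and $w$ components it is taken with respect to zero-mean periodic perturbations and is hence determined up to an additive constant, which is annihilated by $\mathcal J$. The potential $\chi$ in $\mathcal H$ is regarded as a function of $w$ through $\chi_x=w$. A Hamiltonian PDE is one of the form $\partial_t q=\mathcal J\,\delta\mathcal H(q)$ with $\mathcal J$ a (constant-coefficient) skew-symmetric operator with respect to the $L^2$ inner product. *)

theory Defs
  imports "HOL-Analysis.Analysis"
begin

text \<open>
  Profiles in \<open>x\<close> are functions on the whole real line with period \<open>xmax - xmin\<close>;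
  the components of \<open>q :: real \<Rightarrow> real^3\<close> are \<open>q x $ 1 = u\<close>, \<open>q x $ 2 = v\<close>, \<open>q x $ 3 = w\<close>.
\<close>

text \<open>
  On an open set of a Euclidean space, \<open>Ck_on n\<close> is the usual class of \<open>n\<close> times continuously
  differentiable functions, in terms of iterated directional derivatives.
\<close>

primrec Ck_on :: "nat \<Rightarrow> 'a::euclidean_space set \<Rightarrow> ('a \<Rightarrow> 'b::real_normed_vector) \<Rightarrow> bool" where
  "Ck_on 0 S f \<longleftrightarrow> continuous_on S f"
| "Ck_on (Suc n) S f \<longleftrightarrow>
     (\<exists>f'. (\<forall>x\<in>S. (f has_derivative f' x) (at x)) \<and> (\<forall>h. Ck_on n S (\<lambda>x. f' x h)))"

definition smooth_on :: "'a::euclidean_space set \<Rightarrow> ('a \<Rightarrow> 'b::real_normed_vector) \<Rightarrow> bool" where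
  "smooth_on S f \<longleftrightarrow> (\<forall>n. Ck_on n S f)"

definition smooth_periodic :: "real \<Rightarrow> real \<Rightarrow> (real \<Rightarrow> 'b::real_normed_vector) \<Rightarrow> bool" where
  "smooth_periodic xmin xmax f \<longleftrightarrow> smooth_on UNIV f \<and> periodic_fun_simple f (xmax - xmin)"

definition is_potential :: "real \<Rightarrow> real \<Rightarrow> (real \<Rightarrow> real) \<Rightarrow> (real \<Rightarrow> real) \<Rightarrow> bool" where
  "is_potential xmin xmax \<phi> f \<longleftrightarrow>
     smooth_periodic xmin xmax \<phi> \<and> (\<forall>x. (\<phi> has_real_derivative f x) (at x))"

definition phase_space :: "real \<Rightarrow> real \<Rightarrow> (real \<Rightarrow> real^3) set" where
  "phase_space xmin xmax = {q. smooth_periodic xmin xmax q \<and>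
     (\<exists>psi. is_potential xmin xmax psi (\<lambda>x. q x $ 2)) \<and>
     (\<exists>chi. is_potential xmin xmax chi (\<lambda>x. q x $ 3))}"

definition perturbations :: "real \<Rightarrow> real \<Rightarrow> (real \<Rightarrow> real^3) set" where
  "perturbations xmin xmax = {\<eta>. smooth_periodic xmin xmax \<eta> \<and>
     integral {xmin..xmax} (\<lambda>x. \<eta> x $ 2) = 0 \<and> integral {xmin..xmax} (\<lambda>x. \<eta> x $ 3) = 0}"

definition l2_inner :: "real \<Rightarrow> real \<Rightarrow> (real \<Rightarrow> real^3) \<Rightarrow> (real \<Rightarrow> real^3) \<Rightarrow> real" where
  "l2_inner xmin xmax f g = integral {xmin..xmax} (\<lambda>x. f x \<bullet> g x)"

definition has_variational_derivative ::
  "real \<Rightarrow> real \<Rightarrow> ((real \<Rightarrow> real^3) \<Rightarrow> real) \<Rightarrow> (real \<Rightarrow> real^3) \<Rightarrow> (real \<Rightarrow> real^3) \<Rightarrow> bool" where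
  "has_variational_derivative xmin xmax F q g \<longleftrightarrow>
     smooth_periodic xmin xmax g \<and>
     (\<forall>\<eta>\<in>perturbations xmin xmax.
        ((\<lambda>s. F (\<lambda>x. q x + s *\<^sub>R \<eta> x)) has_real_derivative l2_inner xmin xmax g \<eta>) (at 0))"

text \<open>
  The variational derivative is determined only up to additive constants in the second and third
  components; a representative is chosen here. Independence of the choice after applying an
  operator \<open>J\<close> is expressed by \<open>variationally_differentiable\<close>.
\<close>

definition var_deriv ::
  "real \<Rightarrow> real \<Rightarrow> ((real \<Rightarrow> real^3) \<Rightarrow> real) \<Rightarrow> (real \<Rightarrow> real^3) \<Rightarrow> (real \<Rightarrow> real^3)" where
  "var_deriv xmin xmax F q = (SOME g. has_variational_derivative xmin xmax F q g)"

definition variationally_differentiable ::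
  "real \<Rightarrow> real \<Rightarrow> ((real \<Rightarrow> real^3) \<Rightarrow> (real \<Rightarrow> real^3)) \<Rightarrow> ((real \<Rightarrow> real^3) \<Rightarrow> real) \<Rightarrow> bool" where
  "variationally_differentiable xmin xmax J F \<longleftrightarrow>
     (\<forall>q\<in>phase_space xmin xmax.
        (\<exists>g. has_variational_derivative xmin xmax F q g) \<and>
        (\<forall>g h. has_variational_derivative xmin xmax F q g \<and>
               has_variational_derivative xmin xmax F q h \<longrightarrow> J g = J h))"

definition skew_symmetric_op ::
  "real \<Rightarrow> real \<Rightarrow> ((real \<Rightarrow> real^3) \<Rightarrow> (real \<Rightarrow> real^3)) \<Rightarrow> bool" where
  "skew_symmetric_op xmin xmax J \<longleftrightarrow>
     (\<forall>f g. smooth_periodic xmin xmax f \<and> smooth_periodic xmin xmax g \<longrightarrow>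
        l2_inner xmin xmax (J f) g = - l2_inner xmin xmax f (J g))"

definition constant_coefficient_op ::
  "real \<Rightarrow> real \<Rightarrow> ((real \<Rightarrow> real^3) \<Rightarrow> (real \<Rightarrow> real^3)) \<Rightarrow> bool" where
  "constant_coefficient_op xmin xmax J \<longleftrightarrow>
     (\<exists>N (A :: nat \<Rightarrow> real^3^3). \<forall>f. smooth_periodic xmin xmax f \<longrightarrow>
        (\<forall>x. J f x =
           (\<Sum>k\<le>N. A k *v ((\<lambda>h y. vector_derivative h (at y)) ^^ k) f x)))"

text \<open>
  Smooth evolutions \<open>q t x\<close>, with \<open>t\<close> ranging over an open time set \<open>T\<close>, whose time slices lie in
  the phase space.
\<close>

definition smooth_evolution ::
  "real \<Rightarrow> real \<Rightarrow> real set \<Rightarrow> (real \<Rightarrow> real \<Rightarrow> real^3) \<Rightarrow> bool" where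
  "smooth_evolution xmin xmax T q \<longleftrightarrow>
     smooth_on (T \<times> UNIV) (\<lambda>(t, x). q t x) \<and> (\<forall>t\<in>T. q t \<in> phase_space xmin xmax)"

text \<open>
  A PDE is given as a predicate on a time set and an evolution. It is Hamiltonian with structure
  \<open>J\<close> and Hamiltonian \<open>F\<close> if it is equivalent to \<open>q\<^sub>t = J (\<delta>F q)\<close>.
\<close>

definition hamiltonian_pde ::
  "real \<Rightarrow> real \<Rightarrow> (real set \<Rightarrow> (real \<Rightarrow> real \<Rightarrow> real^3) \<Rightarrow> bool) \<Rightarrow>
   ((real \<Rightarrow> real^3) \<Rightarrow> (real \<Rightarrow> real^3)) \<Rightarrow> ((real \<Rightarrow> real^3) \<Rightarrow> real) \<Rightarrow> bool" where
  "hamiltonian_pde xmin xmax pde J F \<longleftrightarrow>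
     constant_coefficient_op xmin xmax J \<and>
     skew_symmetric_op xmin xmax J \<and>
     variationally_differentiable xmin xmax J F \<and>
     (\<forall>T q. open T \<and> smooth_evolution xmin xmax T q \<longrightarrow>
        (pde T q \<longleftrightarrow>
          (\<forall>t\<in>T. \<forall>x. vector_derivative (\<lambda>s. q s x) (at t) = J (var_deriv xmin xmax F (q t)) x)))"

definition relative_equilibrium_structure ::
  "real \<Rightarrow> real \<Rightarrow> ((real \<Rightarrow> real^3) \<Rightarrow> (real \<Rightarrow> real^3)) \<Rightarrow> ((real \<Rightarrow> real^3) \<Rightarrow> real) \<Rightarrow> bool" where
  "relative_equilibrium_structure xmin xmax J F \<longleftrightarrow>
     variationally_differentiable xmin xmax J F \<and>
     (\<forall>q\<in>phase_space xmin xmax. \<forall>x.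
        - vector_derivative q (at x) = J (var_deriv xmin xmax F q) x)"

definition bbmh :: "real \<Rightarrow> real set \<Rightarrow> (real \<Rightarrow> real \<Rightarrow> real^3) \<Rightarrow> bool" where
  "bbmh \<epsilon> T q \<longleftrightarrow> (\<forall>t\<in>T. \<forall>x.
     deriv (\<lambda>s. q s x $ 1) t + q t x $ 1 * deriv (\<lambda>y. q t y $ 1) x + deriv (\<lambda>y. q t y $ 2) x = 0 \<and>
     deriv (\<lambda>s. q s x $ 2) t + 1 / \<epsilon>\<^sup>2 * deriv (\<lambda>y. q t y $ 1) x = 1 / \<epsilon>\<^sup>2 * q t x $ 3 \<and>
     deriv (\<lambda>s. q s x $ 3) t + \<epsilon>\<^sup>2 * deriv (\<lambda>y. q t y $ 3) x = - (q t x $ 2))"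

definition bbmh_J :: "real \<Rightarrow> (real \<Rightarrow> real^3) \<Rightarrow> (real \<Rightarrow> real^3)" where
  "bbmh_J \<epsilon> f = (\<lambda>x. - vector [deriv (\<lambda>y. f y $ 1) x,
                              1 / \<epsilon>\<^sup>2 * deriv (\<lambda>y. f y $ 2) x,
                              deriv (\<lambda>y. f y $ 3) x])"

definition bbmh_H_with ::
  "real \<Rightarrow> real \<Rightarrow> real \<Rightarrow> (real \<Rightarrow> real) \<Rightarrow> (real \<Rightarrow> real^3) \<Rightarrow> real" where
  "bbmh_H_with \<epsilon> xmin xmax chi q = integral {xmin..xmax}
     (\<lambda>x. (q x $ 1) ^ 3 / 6 + q x $ 1 * q x $ 2 - q x $ 2 * chi x + \<epsilon>\<^sup>2 * ((q x $ 3)\<^sup>2 / 2))"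

definition bbmh_H :: "real \<Rightarrow> real \<Rightarrow> real \<Rightarrow> (real \<Rightarrow> real^3) \<Rightarrow> real" where
  "bbmh_H \<epsilon> xmin xmax q =
     bbmh_H_with \<epsilon> xmin xmax (SOME chi. is_potential xmin xmax chi (\<lambda>x. q x $ 3)) q"

definition bbmh_I :: "real \<Rightarrow> real \<Rightarrow> real \<Rightarrow> (real \<Rightarrow> real^3) \<Rightarrow> real" where
  "bbmh_I \<epsilon> xmin xmax q = integral {xmin..xmax}
     (\<lambda>x. (q x $ 1)\<^sup>2 / 2 + \<epsilon>\<^sup>2 * ((q x $ 2)\<^sup>2 / 2) + (q x $ 3)\<^sup>2 / 2)"

end

(* For v = psi' and w = chi' one computes
     dH = (u^2/2 + v, u - chi, psi + eps^2 w)   and   dI = (u, eps^2 v, w);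
   the entry psi arises from the nonlocal term -v chi, since psi' xi + psi xi' integrates to zero
   over a period.  A variational derivative is unique up to an additive constant: test the
   difference of two representatives against itself minus its mean.  Applying J to these
   gradients gives the right-hand sides of the system and -q'. *)

theory Submission
  imports Defs
begin

section \<open>Closure properties of the classes \<open>Ck_on\<close>\<close>

lemma Ck_on_Suc_imp: "Ck_on (Suc n) S f \<Longrightarrow> Ck_on n S f"
proof (induction n arbitrary: f)
  case 0
  then obtain f' where "\<forall>x\<in>S. (f has_derivative f' x) (at x)"
    by auto
  then have "continuous_on S f"
    by (intro has_derivative_continuous_on[where f' = f']) (simp add: has_derivative_at_withinI)
  then show ?case by simp
next
  case (Suc n)
  from Suc.prems obtain f' where f': "\<forall>x\<in>S. (f has_derivative f' x) (at x)"
    "\<forall>h. Ck_on (Suc n) S (\<lambda>x. f' x h)"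
    by (subst (asm) Ck_on.simps(2)) blast
  then have "\<forall>h. Ck_on n S (\<lambda>x. f' x h)"
    using Suc.IH by blast
  with f'(1) show ?case
    by (intro Ck_on.simps(2)[THEN iffD2] exI[of _ f'] conjI)
qed

lemma Ck_on_bounded_linear:
  assumes "bounded_linear L" "Ck_on n S f"
  shows "Ck_on n S (\<lambda>x. L (f x))"
  using assms(2)
proof (induction n arbitrary: f)
  case 0
  then show ?case
    using assms(1) by (simp add: bounded_linear.continuous_on)
next
  case (Suc n)
  then obtain f' where f': "\<forall>x\<in>S. (f has_derivative f' x) (at x)" "\<forall>h. Ck_on n S (\<lambda>x. f' x h)"
    by auto
  then have "\<forall>x\<in>S. ((\<lambda>x. L (f x)) has_derivative (\<lambda>h. L (f' x h))) (at x)"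
    using bounded_linear.has_derivative[OF assms(1)] by blast
  with f'(2) show ?case
    using Suc.IH by (auto intro!: exI[of _ "\<lambda>x h. L (f' x h)"])
qed

lemma Ck_on_const: "Ck_on n S (\<lambda>x. c)"
proof (induction n arbitrary: c)
  case (Suc n)
  then show ?case
    by (intro Ck_on.simps(2)[THEN iffD2] exI[of _ "\<lambda>x h. 0"]) simp
qed simp

lemma Ck_on_add:
  assumes "Ck_on n S f" "Ck_on n S g"
  shows "Ck_on n S (\<lambda>x. f x + g x)"
  using assms
proof (induction n arbitrary: f g)
  case 0
  then show ?case by (simp add: continuous_on_add)
next
  case (Suc n)
  then obtain f' g' where
    "\<forall>x\<in>S. (f has_derivative f' x) (at x)" "\<forall>h. Ck_on n S (\<lambda>x. f' x h)"
    "\<forall>x\<in>S. (g has_derivative g' x) (at x)" "\<forall>h. Ck_on n S (\<lambda>x. g' x h)"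
    by auto
  then show ?case
    using Suc.IH by (auto intro!: exI[of _ "\<lambda>x h. f' x h + g' x h"] derivative_intros)
qed

lemma Ck_on_mult:
  fixes f g :: "'a::euclidean_space \<Rightarrow> 'b::real_normed_algebra"
  assumes "Ck_on n S f" "Ck_on n S g"
  shows "Ck_on n S (\<lambda>x. f x * g x)"
  using assms
proof (induction n arbitrary: f g)
  case 0
  then show ?case by (simp add: continuous_on_mult)
next
  case (Suc n)
  then obtain f' g' where
    f': "\<forall>x\<in>S. (f has_derivative f' x) (at x)" "\<forall>h. Ck_on n S (\<lambda>x. f' x h)" and
    g': "\<forall>x\<in>S. (g has_derivative g' x) (at x)" "\<forall>h. Ck_on n S (\<lambda>x. g' x h)"
    by auto
  \<comment> \<open>In the product rule the factors also occur undifferentiated, so their own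
    regularity of order \<open>n\<close> is needed next to that of their derivatives.\<close>
  have "Ck_on n S f" "Ck_on n S g"
    using Suc.prems by (blast intro: Ck_on_Suc_imp)+
  with f' g' show ?case
    using Suc.IH
    by (auto intro!: exI[of _ "\<lambda>x h. f x * g' x h + f' x h * g x"] derivative_intros Ck_on_add)
qed

text \<open>In a fixed direction \<open>h\<close> the derivative of \<open>F\<close> is just
  \<open>f\<close> times \<open>h\<close>, so \<open>F\<close> gains one order. This makes
  potentials obtained by integration smooth.\<close>

lemma Ck_on_antiderivative:
  assumes "\<And>x. (F has_real_derivative f x) (at x)" "Ck_on n UNIV f"
  shows "Ck_on (Suc n) UNIV F"
proof -
  have "Ck_on n UNIV (\<lambda>x. f x * h)" for h
    using Ck_on_bounded_linear[OF bounded_linear_mult_left assms(2)] .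
  then show ?thesis
    using assms(1) by (auto intro!: exI[of _ "\<lambda>x h. f x * h"] simp: has_field_derivative_def)
qed

section \<open>Smooth periodic functions on the line\<close>

lemma smooth_periodic_add:
  "\<lbrakk>smooth_periodic a b f; smooth_periodic a b g\<rbrakk> \<Longrightarrow> smooth_periodic a b (\<lambda>x. f x + g x)"
  by (auto simp: smooth_periodic_def smooth_on_def periodic_fun_simple_def intro: Ck_on_add)

lemma smooth_periodic_mult:
  fixes f g :: "real \<Rightarrow> 'b::real_normed_algebra"
  shows "\<lbrakk>smooth_periodic a b f; smooth_periodic a b g\<rbrakk> \<Longrightarrow> smooth_periodic a b (\<lambda>x. f x * g x)"
  by (auto simp: smooth_periodic_def smooth_on_def periodic_fun_simple_def intro: Ck_on_mult)

lemma smooth_periodic_const: "smooth_periodic a b (\<lambda>x. c)"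
  by (auto simp: smooth_periodic_def smooth_on_def periodic_fun_simple_def intro: Ck_on_const)

lemma smooth_periodic_bounded_linear:
  "\<lbrakk>bounded_linear L; smooth_periodic a b f\<rbrakk> \<Longrightarrow> smooth_periodic a b (\<lambda>x. L (f x))"
  by (auto simp: smooth_periodic_def smooth_on_def periodic_fun_simple_def intro: Ck_on_bounded_linear)

lemma smooth_periodic_scaleR: "smooth_periodic a b f \<Longrightarrow> smooth_periodic a b (\<lambda>x. c *\<^sub>R f x)"
  by (rule smooth_periodic_bounded_linear[OF bounded_linear_scaleR_right])

lemma smooth_periodic_cmult:
  fixes f :: "real \<Rightarrow> real"
  shows "smooth_periodic a b f \<Longrightarrow> smooth_periodic a b (\<lambda>x. c * f x)"
  by (rule smooth_periodic_bounded_linear[OF bounded_linear_mult_right])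

lemma smooth_periodic_uminus: "smooth_periodic a b f \<Longrightarrow> smooth_periodic a b (\<lambda>x. - f x)"
  using smooth_periodic_scaleR[of a b f "-1"] by simp

lemma smooth_periodic_diff:
  "\<lbrakk>smooth_periodic a b f; smooth_periodic a b g\<rbrakk> \<Longrightarrow> smooth_periodic a b (\<lambda>x. f x - g x)"
  using smooth_periodic_add[OF _ smooth_periodic_uminus, of a b f g] by simp

lemma smooth_periodic_component: "smooth_periodic a b f \<Longrightarrow> smooth_periodic a b (\<lambda>x. f x $ i)"
  by (rule smooth_periodic_bounded_linear[OF bounded_linear_vec_nth])

lemma smooth_periodic_vector_3:
  fixes f g h :: "real \<Rightarrow> real"
  assumes "smooth_periodic a b f" "smooth_periodic a b g" "smooth_periodic a b h"
  shows "smooth_periodic a b (\<lambda>x. vector [f x, g x, h x] :: real^3)"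
proof -
  \<comment> \<open>Expansion in the standard basis reduces the claim to sums and to images under
    bounded linear maps.\<close>
  have "(\<lambda>x. vector [f x, g x, h x] :: real^3) =
        (\<lambda>x. f x *\<^sub>R axis 1 1 + g x *\<^sub>R axis 2 1 + h x *\<^sub>R axis 3 1)"
    by (auto simp: vec_eq_iff forall_3 axis_def)
  then show ?thesis
    by (auto intro!: smooth_periodic_add assms
        smooth_periodic_bounded_linear[OF bounded_linear_scaleR_left])
qed

lemma smooth_periodic_continuous_on:
  assumes "smooth_periodic a b f" shows "continuous_on S f"
proof -
  have "Ck_on 0 UNIV f" using assms by (simp add: smooth_periodic_def smooth_on_def)
  then show ?thesis by (auto intro: continuous_on_subset)
qed

lemma smooth_periodic_has_vector_derivative:
  assumes "smooth_periodic a b f"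
  obtains f' where "\<And>x. (f has_vector_derivative f' x) (at x)" "\<And>S. continuous_on S f'"
proof -
  have "Ck_on (Suc 0) UNIV f" using assms unfolding smooth_periodic_def smooth_on_def by blast
  then obtain f' where f': "\<And>x. (f has_derivative f' x) (at x)"
    "\<And>h. continuous_on UNIV (\<lambda>x. f' x h)"
    by auto
  \<comment> \<open>A linear map on the line is determined by its value at 1. That value is the
    vector derivative, and it is continuous in \<open>x\<close> by the instance \<open>h = 1\<close>
    of the assumption.\<close>
  have "f' x h = h *\<^sub>R f' x 1" for x h
    using linear_cmul[OF has_derivative_linear[OF f'(1)[of x]], of h 1] by simp
  then have "f' x = (\<lambda>h. h *\<^sub>R f' x 1)" for x
    by blast
  then have "(f has_vector_derivative f' x 1) (at x)" for x
    using f'(1)[of x] unfolding has_vector_derivative_def by metis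
  moreover have "continuous_on S (\<lambda>x. f' x 1)" for S
    using f'(2)[of 1] by (rule continuous_on_subset) simp
  ultimately show thesis
    by (rule that)
qed

lemma smooth_periodic_has_real_derivative:
  fixes f :: "real \<Rightarrow> real"
  assumes "smooth_periodic a b f"
  shows "(f has_real_derivative deriv f x) (at x)" "continuous_on S (deriv f)"
proof -
  obtain f' where f': "\<And>x. (f has_vector_derivative f' x) (at x)" "\<And>S. continuous_on S f'"
    using smooth_periodic_has_vector_derivative[OF assms] by blast
  then have "deriv f = f'"
    by (auto simp: fun_eq_iff has_real_derivative_iff_has_vector_derivative intro!: DERIV_imp_deriv)
  then show "(f has_real_derivative deriv f x) (at x)" "continuous_on S (deriv f)"
    using f' by (simp_all add: has_real_derivative_iff_has_vector_derivative)
qed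

lemma smooth_periodic_endpoints: "smooth_periodic a b f \<Longrightarrow> f b = f a"
  using periodic_fun_simple.plus_period[of f "b - a" a] by (simp add: smooth_periodic_def)

lemma smooth_periodic_eq_all:
  assumes f: "smooth_periodic a b f" and "a < b" and eq: "\<And>x. x \<in> {a..b} \<Longrightarrow> f x = c"
  shows "f x = c"
proof -
  interpret periodic_fun_simple f "b - a"
    using f by (simp add: smooth_periodic_def)
  \<comment> \<open>The number of whole periods from \<open>a\<close> to \<open>x\<close>, rounded
    down; moving back by it lands in the base interval.\<close>
  define k where "k = \<lfloor>(x - a) / (b - a)\<rfloor>"
  have "of_int k \<le> (x - a) / (b - a)" "(x - a) / (b - a) \<le> of_int k + 1"
    unfolding k_def by linarith+
  with \<open>a < b\<close> have "x - of_int k * (b - a) \<in> {a..b}"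
    by (simp add: field_simps)
  then show ?thesis
    using eq minus_of_int by metis
qed

section \<open>Periodic potentials and zero mean\<close>

text \<open>The fundamental theorem of calculus with equal boundary values. Integration by parts is
  done below through this fact, by exhibiting a periodic product as a potential of the
  integrand.\<close>

lemma is_potential_mean_zero:
  assumes "is_potential a b \<phi> f" "a \<le> b"
  shows "integral {a..b} f = 0"
proof -
  have "(f has_integral \<phi> b - \<phi> a) {a..b}"
    using assms unfolding is_potential_def
    by (intro fundamental_theorem_of_calculus)
       (auto simp: has_real_derivative_iff_has_vector_derivative intro: has_vector_derivative_at_within)
  then show ?thesis
    using assms smooth_periodic_endpoints[of a b \<phi>] by (simp add: is_potential_def integral_unique)
qed

text \<open>Any antiderivative \<open>F\<close> on the whole line works. Its increment over one
  period has derivative \<open>f (x + (b - a)) - f x = 0\<close> and is therefore constant; at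
  \<open>a\<close> it equals the integral of \<open>f\<close>, which vanishes.\<close>

lemma is_potential_exists:
  assumes f: "smooth_periodic a b f" and "a < b" and mean: "integral {a..b} f = 0"
  obtains \<phi> where "is_potential a b \<phi> f"
proof -
  have cont: "continuous_on UNIV f"
    using f by (rule smooth_periodic_continuous_on)
  obtain F where "\<And>x. (F has_vector_derivative f x) (at x)"
    using einterval_antiderivative[of "-\<infinity>" "\<infinity>" f] cont
    by (auto simp: continuous_on_eq_continuous_at)
  then have F: "(F has_real_derivative f x) (at x)" for x
    by (simp add: has_real_derivative_iff_has_vector_derivative)
  have ab: "F b = F a"
  proof -
    have "(f has_integral F b - F a) {a..b}"
      using F \<open>a < b\<close>
      by (intro fundamental_theorem_of_calculus)
       (auto simp: has_real_derivative_iff_has_vector_derivative intro: has_vector_derivative_at_within)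
    with mean show ?thesis by (simp add: integral_unique)
  qed
  have per: "f (x + (b - a)) = f x" for x
    using f by (simp add: smooth_periodic_def periodic_fun_simple_def)
  have "((\<lambda>x. F (x + (b - a)) - F x) has_real_derivative 0) (at x)" for x
    using DERIV_shift[THEN iffD1, OF F[of "x + (b - a)"]] F[of x]
    by (auto intro!: derivative_eq_intros simp: per)
  then have "F (x + (b - a)) - F x = F (a + (b - a)) - F a" for x
    using DERIV_isconst_all[of "\<lambda>x. F (x + (b - a)) - F x"] by blast
  then have "F (x + (b - a)) = F x" for x
    using ab by simp
  moreover have "Ck_on n UNIV F" for n
    using f Ck_on_antiderivative[OF F] Ck_on_Suc_imp
    unfolding smooth_periodic_def smooth_on_def by blast
  ultimately have "is_potential a b F f"
    using F by (auto simp: is_potential_def smooth_periodic_def smooth_on_def periodic_fun_simple_def)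
  then show thesis by (rule that)
qed

lemma is_potential_linear_combination:
  assumes "is_potential a b \<phi> f" "is_potential a b \<psi> g"
  shows "is_potential a b (\<lambda>x. \<phi> x + s * \<psi> x) (\<lambda>x. f x + s * g x)"
  using assms unfolding is_potential_def
  by (auto intro!: smooth_periodic_add smooth_periodic_cmult derivative_eq_intros)

text \<open>The additive constant is the whole ambiguity in the choice of a potential inside
  \<open>bbmh_H\<close>.\<close>

lemma is_potential_unique:
  assumes "is_potential a b \<phi> f" "is_potential a b \<psi> f"
  obtains c where "\<And>x. \<phi> x = \<psi> x + c"
proof -
  have "((\<lambda>x. \<phi> x - \<psi> x) has_real_derivative 0) (at x)" for x
    using assms by (auto simp: is_potential_def intro!: derivative_eq_intros)
  then have "\<phi> x - \<psi> x = \<phi> 0 - \<psi> 0" for x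
    using DERIV_isconst_all[of "\<lambda>x. \<phi> x - \<psi> x"] by blast
  then show thesis
    by (intro that[of "\<phi> 0 - \<psi> 0"]) (simp add: algebra_simps)
qed

section \<open>Variations inside the phase space\<close>

lemma perturbationsE:
  assumes "\<eta> \<in> perturbations a b" "a < b"
  obtains \<zeta> \<xi> where "is_potential a b \<zeta> (\<lambda>x. \<eta> x $ 2)" "is_potential a b \<xi> (\<lambda>x. \<eta> x $ 3)"
proof -
  have s\<eta>: "smooth_periodic a b (\<lambda>x. \<eta> x $ i)" for i
    using assms(1) by (simp add: perturbations_def smooth_periodic_component)
  have mean: "integral {a..b} (\<lambda>x. \<eta> x $ 2) = 0" "integral {a..b} (\<lambda>x. \<eta> x $ 3) = 0"
    using assms(1) by (simp_all add: perturbations_def)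
  obtain \<zeta> where "is_potential a b \<zeta> (\<lambda>x. \<eta> x $ 2)"
    by (rule is_potential_exists[OF s\<eta> \<open>a < b\<close> mean(1)])
  moreover obtain \<xi> where "is_potential a b \<xi> (\<lambda>x. \<eta> x $ 3)"
    by (rule is_potential_exists[OF s\<eta> \<open>a < b\<close> mean(2)])
  ultimately show thesis by (rule that)
qed

text \<open>Potentials combine linearly along the line through \<open>q\<close> in direction
  \<open>\<eta>\<close>. The line must stay in the phase space because there the value of
  \<open>bbmh_H\<close> can be computed with any convenient potential.\<close>

lemma phase_space_add_perturbation:
  assumes "q \<in> phase_space a b" "\<eta> \<in> perturbations a b" "a < b"
  shows "(\<lambda>x. q x + s *\<^sub>R \<eta> x) \<in> phase_space a b"
proof -
  obtain \<zeta> \<xi> where pot: "is_potential a b \<zeta> (\<lambda>x. \<eta> x $ 2)" "is_potential a b \<xi> (\<lambda>x. \<eta> x $ 3)"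
    using perturbationsE[OF assms(2,3)] .
  have "smooth_periodic a b (\<lambda>x. q x + s *\<^sub>R \<eta> x)"
    using assms by (auto simp: phase_space_def perturbations_def
        intro!: smooth_periodic_add smooth_periodic_scaleR)
  moreover obtain psi chi where "is_potential a b psi (\<lambda>x. q x $ 2)" "is_potential a b chi (\<lambda>x. q x $ 3)"
    using assms(1) by (auto simp: phase_space_def)
  then have "is_potential a b (\<lambda>x. psi x + s * \<zeta> x) (\<lambda>x. (q x + s *\<^sub>R \<eta> x) $ 2)"
    "is_potential a b (\<lambda>x. chi x + s * \<xi> x) (\<lambda>x. (q x + s *\<^sub>R \<eta> x) $ 3)"
    using is_potential_linear_combination pot by auto
  ultimately show ?thesis
    unfolding phase_space_def by blast
qed

section \<open>Uniqueness of the variational derivative up to constants\<close>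

text \<open>A continuous nonnegative integrand with zero integral vanishes on one period, and
  periodicity carries this to the whole line.\<close>

lemma smooth_periodic_null:
  fixes f :: "real \<Rightarrow> 'b::real_inner"
  assumes f: "smooth_periodic a b f" and "a < b" and int: "integral {a..b} (\<lambda>x. f x \<bullet> f x) = 0"
  shows "f x = 0"
proof -
  have "continuous_on {a..b} (\<lambda>x. f x \<bullet> f x)"
    using f by (intro continuous_on_inner smooth_periodic_continuous_on)
  from integral_eq_0_iff[OF this \<open>a < b\<close>] int have "\<forall>x\<in>{a..b}. f x = 0"
    by simp
  then show ?thesis
    using smooth_periodic_eq_all[OF f \<open>a < b\<close>] by blast
qed

lemma has_variational_derivative_unique:
  assumes g: "has_variational_derivative a b F q g" and h: "has_variational_derivative a b F q h"
    and "a < b"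
  obtains c where "\<And>x. g x = h x + c"
proof -
  define d where "d = (\<lambda>x. g x - h x)"
  have sp: "smooth_periodic a b g" "smooth_periodic a b h" "smooth_periodic a b d"
    using g h by (auto simp: has_variational_derivative_def d_def intro: smooth_periodic_diff)
  define m :: "real^3" where "m = vector [0, integral {a..b} (\<lambda>x. d x $ 2) / (b - a),
      integral {a..b} (\<lambda>x. d x $ 3) / (b - a)]"
  \<comment> \<open>The first component is not constrained to zero mean, so only the other two are corrected.\<close>
  define \<eta> where "\<eta> = (\<lambda>x. d x - m)"
  have sp\<eta>: "smooth_periodic a b \<eta>"
    unfolding \<eta>_def by (intro smooth_periodic_diff smooth_periodic_const sp)
  have int: "f integrable_on {a..b}" if "smooth_periodic a b f" for f :: "real \<Rightarrow> real"
    using that by (intro integrable_continuous_real smooth_periodic_continuous_on)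
  have int\<eta>: "integral {a..b} (\<lambda>x. \<eta> x $ i) = integral {a..b} (\<lambda>x. d x $ i) - (b - a) * m $ i" for i
    using integral_diff[OF int[OF smooth_periodic_component[OF sp(3)]] integrable_const_ivl, of i "m $ i"]
      \<open>a < b\<close> by (simp add: \<eta>_def)
  have "(b - a) * m $ 2 = integral {a..b} (\<lambda>x. d x $ 2)" "(b - a) * m $ 3 = integral {a..b} (\<lambda>x. d x $ 3)"
    using \<open>a < b\<close> by (simp_all add: m_def)
  then have mean: "integral {a..b} (\<lambda>x. \<eta> x $ 2) = 0" "integral {a..b} (\<lambda>x. \<eta> x $ 3) = 0"
    by (simp_all only: int\<eta> diff_self)
  then have "\<eta> \<in> perturbations a b"
    by (simp add: perturbations_def sp\<eta>)
  \<comment> \<open>Both inner products are the derivative at 0 of the same function of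
    \<open>s\<close>.\<close>
  then have "l2_inner a b g \<eta> = l2_inner a b h \<eta>"
    using g h by (auto simp: has_variational_derivative_def intro: DERIV_unique)
  moreover have cont: "continuous_on {a..b} g" "continuous_on {a..b} h" "continuous_on {a..b} \<eta>"
    using sp sp\<eta> by (auto intro: smooth_periodic_continuous_on)
  moreover have "integral {a..b} (\<lambda>x. d x \<bullet> \<eta> x) = l2_inner a b g \<eta> - l2_inner a b h \<eta>"
    unfolding l2_inner_def d_def inner_diff_left
    by (intro integral_diff integrable_continuous_real continuous_on_inner cont)
  \<comment> \<open>The constant \<open>m\<close> is orthogonal to \<open>\<eta>\<close>: its first
    entry is zero, and the other two entries meet components of zero mean.\<close>
  moreover have "integral {a..b} (\<lambda>x. m \<bullet> \<eta> x) = 0"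
  proof -
    have "m $ 1 = 0"
      by (simp add: m_def)
    then show ?thesis
      by (simp add: inner_vec_def sum_3 integral_add int mean
          smooth_periodic_cmult smooth_periodic_component sp\<eta>)
  qed
  moreover have "integral {a..b} (\<lambda>x. \<eta> x \<bullet> \<eta> x)
      = integral {a..b} (\<lambda>x. d x \<bullet> \<eta> x) - integral {a..b} (\<lambda>x. m \<bullet> \<eta> x)"
    \<comment> \<open>The definition is opened so that the left factor splits, and then folded back
      in the right factor.\<close>
    unfolding \<eta>_def[THEN fun_cong, of "_ :: real"] inner_diff_left
    unfolding \<eta>_def[THEN fun_cong, symmetric]
    by (intro integral_diff integrable_continuous_real continuous_on_inner continuous_on_const
        cont smooth_periodic_continuous_on[OF sp(3)])
  ultimately have "\<eta> x = 0" for x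
    by (intro smooth_periodic_null[OF sp\<eta> \<open>a < b\<close>]) simp
  then show thesis
    by (intro that[of m]) (simp add: \<eta>_def d_def algebra_simps)
qed

section \<open>The operator \<open>bbmh_J\<close>\<close>

lemma deriv_component:
  "(f has_vector_derivative f') (at x) \<Longrightarrow> deriv (\<lambda>y. f y $ i) x = f' $ i"
  using bounded_linear.has_vector_derivative[OF bounded_linear_vec_nth]
  by (intro DERIV_imp_deriv) (auto simp: has_real_derivative_iff_has_vector_derivative)

lemma smooth_periodic_vector_derivative_component:
  assumes "smooth_periodic a b f"
  shows "vector_derivative f (at x) $ i = deriv (\<lambda>y. f y $ i) x"
proof -
  obtain f' where "\<And>x. (f has_vector_derivative f' x) (at x)"
    using smooth_periodic_has_vector_derivative[OF assms] by metis
  from this[of x] show ?thesis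
    by (simp add: vector_derivative_at deriv_component)
qed

text \<open>One formula for all three entries allows arguments with a generic index.\<close>

lemma bbmh_J_component:
  "bbmh_J \<epsilon> f x $ i = - ((vector [1, 1 / \<epsilon>\<^sup>2, 1] :: real^3) $ i * deriv (\<lambda>y. f y $ i) x)"
  using exhaust_3[of i] by (elim disjE) (simp_all add: bbmh_J_def)

lemma bbmh_J_add_const:
  assumes "smooth_periodic a b f"
  shows "bbmh_J \<epsilon> (\<lambda>x. f x + c) = bbmh_J \<epsilon> f"
proof -
  have "deriv (\<lambda>y. f y $ i + c $ i) x = deriv (\<lambda>y. f y $ i) x" for i x
    using smooth_periodic_has_real_derivative(1)[OF smooth_periodic_component[OF assms]]
    by (intro DERIV_imp_deriv) (auto intro!: derivative_eq_intros)
  then show ?thesis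
    by (simp add: bbmh_J_def)
qed

lemma constant_coefficient_bbmh_J: "constant_coefficient_op a b (bbmh_J \<epsilon>)"
proof -
  \<comment> \<open>Order \<open>N = 1\<close> suffices: the zeroth-order matrix is zero and the
    first-order one carries the diagonal of the operator.\<close>
  define A :: "nat \<Rightarrow> real^3^3" where
    "A k = (\<chi> i j. if k = 1 \<and> i = j then - (vector [1, 1 / \<epsilon>\<^sup>2, 1] :: real^3) $ i else 0)" for k
  have "bbmh_J \<epsilon> f x = (\<Sum>k\<le>1. A k *v ((\<lambda>h y. vector_derivative h (at y)) ^^ k) f x)"
    if "smooth_periodic a b f" for f x
    using smooth_periodic_vector_derivative_component[OF that]
    by (auto simp: vec_eq_iff forall_3 A_def matrix_vector_mult_def bbmh_J_component sum_3)
  then show ?thesis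
    unfolding constant_coefficient_op_def by blast
qed

text \<open>The sum of the two integrands is the exact derivative of minus the product of
  \<open>f\<close> and \<open>g\<close> weighted by 1, \<open>1 / \<epsilon>\<^sup>2\<close>, 1, so
  it integrates to zero over a period.\<close>

lemma skew_symmetric_bbmh_J:
  assumes "a \<le> b"
  shows "skew_symmetric_op a b (bbmh_J \<epsilon>)"
  unfolding skew_symmetric_op_def
proof (intro allI impI, elim conjE)
  fix f g :: "real \<Rightarrow> real^3"
  assume f: "smooth_periodic a b f" and g: "smooth_periodic a b g"
  note fi = smooth_periodic_component[OF f] and gi = smooth_periodic_component[OF g]
  note df = smooth_periodic_has_real_derivative[OF fi] and dg = smooth_periodic_has_real_derivative[OF gi]
  define c where "c = 1 / \<epsilon>\<^sup>2"
  have "is_potential a b (\<lambda>x. - (f x $ 1 * g x $ 1 + c * (f x $ 2 * g x $ 2) + f x $ 3 * g x $ 3))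
      (\<lambda>x. bbmh_J \<epsilon> f x \<bullet> g x + f x \<bullet> bbmh_J \<epsilon> g x)"
    unfolding is_potential_def
  proof (intro conjI allI)
    show "smooth_periodic a b
        (\<lambda>x. - (f x $ 1 * g x $ 1 + c * (f x $ 2 * g x $ 2) + f x $ 3 * g x $ 3))"
      by (intro smooth_periodic_uminus smooth_periodic_add smooth_periodic_mult
          smooth_periodic_cmult fi gi)
  qed (auto intro!: derivative_eq_intros df dg
      simp: inner_vec_def sum_3 bbmh_J_component algebra_simps simp flip: c_def)
  then have mean: "integral {a..b} (\<lambda>x. bbmh_J \<epsilon> f x \<bullet> g x + f x \<bullet> bbmh_J \<epsilon> g x) = 0"
    using \<open>a \<le> b\<close> by (rule is_potential_mean_zero)
  \<comment> \<open>Continuity makes both integrands integrable, so that the integral of their sum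
    can be split.\<close>
  have contJ: "continuous_on {a..b} (bbmh_J \<epsilon> h)" if "smooth_periodic a b h" for h
  proof -
    have "continuous_on {a..b} (\<lambda>x. bbmh_J \<epsilon> h x $ i)" for i
      unfolding bbmh_J_component
      by (intro continuous_on_minus continuous_on_mult_left
          smooth_periodic_has_real_derivative(2)[OF smooth_periodic_component[OF that]])
    then show ?thesis
      using continuous_on_vec_lambda[of "{a..b}" "\<lambda>i x. bbmh_J \<epsilon> h x $ i"] by simp
  qed
  have "(\<lambda>x. bbmh_J \<epsilon> f x \<bullet> g x) integrable_on {a..b}"
    "(\<lambda>x. f x \<bullet> bbmh_J \<epsilon> g x) integrable_on {a..b}"
    by (intro integrable_continuous_real continuous_on_inner contJ f g
        smooth_periodic_continuous_on[OF f] smooth_periodic_continuous_on[OF g])+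
  then show "l2_inner a b (bbmh_J \<epsilon> f) g = - l2_inner a b f (bbmh_J \<epsilon> g)"
    using mean by (simp add: l2_inner_def integral_add)
qed

text \<open>Since \<open>var_deriv\<close> is an unspecified representative, this is the way to
  compute with it: any explicit gradient may replace it, because the two differ by a constant, which
  \<open>bbmh_J\<close> annihilates.\<close>

lemma bbmh_J_var_deriv:
  assumes "has_variational_derivative a b F q g" "a < b"
  shows "bbmh_J \<epsilon> (var_deriv a b F q) = bbmh_J \<epsilon> g"
proof -
  have var: "has_variational_derivative a b F q (var_deriv a b F q)"
    unfolding var_deriv_def by (rule someI[of "has_variational_derivative a b F q"]) (rule assms(1))
  obtain c where "\<And>x. var_deriv a b F q x = g x + c"
    using has_variational_derivative_unique[OF var assms] by blast
  then have "var_deriv a b F q = (\<lambda>x. g x + c)" ..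
  then show ?thesis
    using assms(1) by (auto simp: has_variational_derivative_def intro: bbmh_J_add_const)
qed

text \<open>Any two representatives agree under \<open>bbmh_J\<close> by comparison with
  \<open>var_deriv\<close>; for each functional only a gradient has to be supplied.\<close>

lemma variationally_differentiable_bbmh_J:
  assumes "\<And>q. q \<in> phase_space a b \<Longrightarrow> \<exists>g. has_variational_derivative a b F q g" "a < b"
  shows "variationally_differentiable a b (bbmh_J \<epsilon>) F"
  unfolding variationally_differentiable_def
proof (intro ballI conjI allI impI)
  show "bbmh_J \<epsilon> g = bbmh_J \<epsilon> h"
    if "has_variational_derivative a b F q g \<and> has_variational_derivative a b F q h" for q g h
    using that bbmh_J_var_deriv[OF _ \<open>a < b\<close>, of F q] by metis
qed (rule assms(1))

section \<open>Gradients of the two functionals\<close>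

text \<open>Along a line both functionals integrate a polynomial in \<open>s\<close> of degree at
  most three. Splitting the integral by coefficients avoids differentiation under the integral
  sign.\<close>

lemma has_derivative_integral_cubic:
  fixes p0 p1 p2 p3 :: "real \<Rightarrow> real"
  assumes "p0 integrable_on S" "p1 integrable_on S" "p2 integrable_on S" "p3 integrable_on S"
  shows "((\<lambda>s. integral S (\<lambda>x. p0 x + s * p1 x + s\<^sup>2 * p2 x + s ^ 3 * p3 x))
          has_real_derivative integral S p1) (at 0)"
proof -
  have "integral S (\<lambda>x. p0 x + s * p1 x + s\<^sup>2 * p2 x + s ^ 3 * p3 x) =
      integral S p0 + s * integral S p1 + s\<^sup>2 * integral S p2 + s ^ 3 * integral S p3" for s
    by (intro integral_unique has_integral_add has_integral_mult_right integrable_integral assms)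
  then show ?thesis
    by (auto intro!: derivative_eq_intros)
qed

lemma bbmh_I_variational_derivative:
  assumes q: "smooth_periodic a b q"
  shows "has_variational_derivative a b (bbmh_I \<epsilon> a b) q
    (\<lambda>x. vector [q x $ 1, \<epsilon>\<^sup>2 * q x $ 2, q x $ 3])"
    (is "has_variational_derivative a b _ q ?g")
  unfolding has_variational_derivative_def
proof (intro conjI ballI)
  note sq = smooth_periodic_component[OF q]
  show "smooth_periodic a b ?g"
    by (intro smooth_periodic_vector_3 smooth_periodic_cmult sq)
  fix \<eta> assume \<eta>: "\<eta> \<in> perturbations a b"
  then have s\<eta>: "smooth_periodic a b (\<lambda>x. \<eta> x $ i)" for i
    by (simp add: perturbations_def smooth_periodic_component)
  note cont = continuous_intros smooth_periodic_continuous_on[OF sq] smooth_periodic_continuous_on[OF s\<eta>]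
  let ?p = "\<lambda>f x. (f x $ 1)\<^sup>2 / 2 + \<epsilon>\<^sup>2 * ((f x $ 2)\<^sup>2 / 2) + (f x $ 3 :: real)\<^sup>2 / 2"
  \<comment> \<open>The zero cubic term matches the shape of
    \<open>has_derivative_integral_cubic\<close>; the linear coefficient is already the gradient
    paired with \<open>\<eta>\<close>.\<close>
  have I: "bbmh_I \<epsilon> a b (\<lambda>x. q x + s *\<^sub>R \<eta> x) =
      integral {a..b} (\<lambda>x. ?p q x + s * (?g x \<bullet> \<eta> x) + s\<^sup>2 * ?p \<eta> x + s ^ 3 * 0)" for s
    unfolding bbmh_I_def
    by (intro integral_cong) (simp add: inner_vec_def sum_3 field_simps power2_eq_square)
  have "?p q integrable_on {a..b}" "?p \<eta> integrable_on {a..b}" "(\<lambda>x. ?g x \<bullet> \<eta> x) integrable_on {a..b}"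
    by (auto simp: inner_vec_def sum_3 intro!: integrable_continuous_real cont)
  then show "((\<lambda>s. bbmh_I \<epsilon> a b (\<lambda>x. q x + s *\<^sub>R \<eta> x))
      has_real_derivative l2_inner a b ?g \<eta>) (at 0)"
    unfolding I l2_inner_def by (intro has_derivative_integral_cubic) auto
qed

text \<open>Adding a constant \<open>c\<close> to the potential changes the integral by
  \<open>c\<close> times the integral of the second component, which is zero because that component
  has a periodic potential.\<close>

lemma bbmh_H_eq:
  assumes q: "q \<in> phase_space a b" and chi: "is_potential a b chi (\<lambda>x. q x $ 3)" and "a \<le> b"
  shows "bbmh_H \<epsilon> a b q = bbmh_H_with \<epsilon> a b chi q"
proof -
  define chi' where "chi' = (SOME chi. is_potential a b chi (\<lambda>x. q x $ 3))"
  have chi': "is_potential a b chi' (\<lambda>x. q x $ 3)"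
    unfolding chi'_def by (rule someI[of "\<lambda>chi. is_potential a b chi _"]) (rule chi)
  obtain c where c: "\<And>x. chi' x = chi x + c"
    using is_potential_unique[OF chi' chi] by blast
  have sq: "smooth_periodic a b q"
    using q by (simp add: phase_space_def)
  have cont: "continuous_on {a..b} (\<lambda>x. q x $ i)" for i
    using sq by (intro smooth_periodic_continuous_on smooth_periodic_component)
  have contchi: "continuous_on {a..b} chi"
    using chi by (auto simp: is_potential_def intro: smooth_periodic_continuous_on)
  have mean: "integral {a..b} (\<lambda>x. q x $ 2) = 0"
    using q \<open>a \<le> b\<close> by (auto simp: phase_space_def intro: is_potential_mean_zero)
  have "bbmh_H \<epsilon> a b q = integral {a..b} (\<lambda>x. (q x $ 1 ^ 3 / 6 + q x $ 1 * q x $ 2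
      - q x $ 2 * chi x + \<epsilon>\<^sup>2 * ((q x $ 3)\<^sup>2 / 2)) - c * q x $ 2)"
    by (simp add: bbmh_H_def bbmh_H_with_def c algebra_simps flip: chi'_def)
  also have "\<dots> = bbmh_H_with \<epsilon> a b chi q - integral {a..b} (\<lambda>x. c * q x $ 2)"
    unfolding bbmh_H_with_def
    by (rule integral_diff) (auto intro!: integrable_continuous_real continuous_intros cont contchi)
  finally show ?thesis
    by (simp add: mean)
qed

lemma bbmh_H_variational_derivative:
  assumes q: "q \<in> phase_space a b" and psi: "is_potential a b psi (\<lambda>x. q x $ 2)"
    and chi: "is_potential a b chi (\<lambda>x. q x $ 3)" and "a < b"
  shows "has_variational_derivative a b (bbmh_H \<epsilon> a b) q
    (\<lambda>x. vector [(q x $ 1)\<^sup>2 / 2 + q x $ 2, q x $ 1 - chi x, psi x + \<epsilon>\<^sup>2 * q x $ 3])"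
    (is "has_variational_derivative a b _ q ?g")
  unfolding has_variational_derivative_def
proof (intro conjI ballI)
  have sq: "smooth_periodic a b (\<lambda>x. q x $ i)" for i
    using q by (simp add: phase_space_def smooth_periodic_component)
  have spot: "smooth_periodic a b psi" "smooth_periodic a b chi"
    using psi chi by (auto simp: is_potential_def)
  have "smooth_periodic a b (\<lambda>x. (q x $ 1)\<^sup>2 / 2)"
    using smooth_periodic_cmult[OF smooth_periodic_mult[OF sq sq], of "1 / 2" 1 1]
    by (simp add: power2_eq_square)
  then show "smooth_periodic a b ?g"
    by (intro smooth_periodic_vector_3 smooth_periodic_add smooth_periodic_diff
        smooth_periodic_cmult sq spot)
  fix \<eta> assume \<eta>: "\<eta> \<in> perturbations a b"
  then have s\<eta>: "smooth_periodic a b (\<lambda>x. \<eta> x $ i)" for i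
    by (simp add: perturbations_def smooth_periodic_component)
  obtain \<xi> where xi: "is_potential a b \<xi> (\<lambda>x. \<eta> x $ 3)"
    using perturbationsE[OF \<eta> \<open>a < b\<close>] by blast
  then have s\<xi>: "smooth_periodic a b \<xi>"
    by (simp add: is_potential_def)
  note cont = continuous_intros smooth_periodic_continuous_on[OF sq] smooth_periodic_continuous_on[OF s\<eta>]
    smooth_periodic_continuous_on[OF s\<xi>] spot[THEN smooth_periodic_continuous_on]
  let ?p0 = "\<lambda>x. (q x $ 1) ^ 3 / 6 + q x $ 1 * q x $ 2 - q x $ 2 * chi x + \<epsilon>\<^sup>2 * ((q x $ 3)\<^sup>2 / 2)"
  \<comment> \<open>The linear coefficient contains no \<open>psi\<close>. It is written as the
    pairing with the proposed gradient, corrected by two terms that together will integrate to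
    zero.\<close>
  let ?p1 = "\<lambda>x. ?g x \<bullet> \<eta> x - (q x $ 2 * \<xi> x + psi x * \<eta> x $ 3)"
  let ?p2 = "\<lambda>x. q x $ 1 * (\<eta> x $ 1)\<^sup>2 / 2 + \<eta> x $ 1 * \<eta> x $ 2 - \<eta> x $ 2 * \<xi> x + \<epsilon>\<^sup>2 * ((\<eta> x $ 3)\<^sup>2 / 2)"
  let ?p3 = "\<lambda>x. (\<eta> x $ 1) ^ 3 / 6"
  have H: "bbmh_H \<epsilon> a b (\<lambda>x. q x + s *\<^sub>R \<eta> x) =
      integral {a..b} (\<lambda>x. ?p0 x + s * ?p1 x + s\<^sup>2 * ?p2 x + s ^ 3 * ?p3 x)" for s
  proof -
    \<comment> \<open>The potential chosen inside \<open>bbmh_H\<close> could depend on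
      \<open>s\<close> in any way; replacing it by \<open>chi x + s * \<xi> x\<close> makes the
      integrand polynomial in \<open>s\<close>.\<close>
    have "bbmh_H \<epsilon> a b (\<lambda>x. q x + s *\<^sub>R \<eta> x) =
        bbmh_H_with \<epsilon> a b (\<lambda>x. chi x + s * \<xi> x) (\<lambda>x. q x + s *\<^sub>R \<eta> x)"
      using is_potential_linear_combination[OF chi xi] \<open>a < b\<close>
      by (intro bbmh_H_eq phase_space_add_perturbation q \<eta>) auto
    also have "\<dots> = integral {a..b} (\<lambda>x. ?p0 x + s * ?p1 x + s\<^sup>2 * ?p2 x + s ^ 3 * ?p3 x)"
      unfolding bbmh_H_with_def
      by (intro integral_cong)
         (simp add: inner_vec_def sum_3 algebra_simps add_divide_distrib diff_divide_distrib
           power2_eq_square power3_eq_cube)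
    finally show ?thesis .
  qed
  have int: "(\<lambda>x. ?g x \<bullet> \<eta> x) integrable_on {a..b}"
    "(\<lambda>x. q x $ 2 * \<xi> x + psi x * \<eta> x $ 3) integrable_on {a..b}"
    by (auto simp: inner_vec_def sum_3 intro!: integrable_continuous_real cont)
  \<comment> \<open>The correction in \<open>?p1\<close> is the derivative of a periodic
    product.\<close>
  have "is_potential a b (\<lambda>x. psi x * \<xi> x) (\<lambda>x. q x $ 2 * \<xi> x + psi x * \<eta> x $ 3)"
    using psi xi
    by (auto simp: is_potential_def intro!: smooth_periodic_mult derivative_eq_intros)
  from is_potential_mean_zero[OF this] \<open>a < b\<close> int have "integral {a..b} ?p1 = l2_inner a b ?g \<eta>"
    by (simp add: integral_diff l2_inner_def)
  moreover have "?p0 integrable_on {a..b}" "?p2 integrable_on {a..b}" "?p3 integrable_on {a..b}"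
    by (auto intro!: integrable_continuous_real cont)
  ultimately show "((\<lambda>s. bbmh_H \<epsilon> a b (\<lambda>x. q x + s *\<^sub>R \<eta> x))
      has_real_derivative l2_inner a b ?g \<eta>) (at 0)"
    unfolding H using has_derivative_integral_cubic[of ?p0 "{a..b}" ?p1 ?p2 ?p3] int
    by (simp add: integrable_diff)
qed

section \<open>The two structures of the system\<close>

lemma relative_equilibrium_structure_bbmh:
  assumes "\<epsilon> > 0" and "a < b"
  shows "relative_equilibrium_structure a b (bbmh_J \<epsilon>) (bbmh_I \<epsilon> a b)"
proof -
  have I: "has_variational_derivative a b (bbmh_I \<epsilon> a b) q
      (\<lambda>x. vector [q x $ 1, \<epsilon>\<^sup>2 * q x $ 2, q x $ 3])" if "q \<in> phase_space a b" for q
    using that by (intro bbmh_I_variational_derivative) (simp add: phase_space_def)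
  have "- vector_derivative q (at x) = bbmh_J \<epsilon> (var_deriv a b (bbmh_I \<epsilon> a b) q) x"
    if q: "q \<in> phase_space a b" for q x
  proof -
    have sq: "smooth_periodic a b q"
      using q by (simp add: phase_space_def)
    have "deriv (\<lambda>y. \<epsilon>\<^sup>2 * q y $ 2) x = \<epsilon>\<^sup>2 * deriv (\<lambda>y. q y $ 2) x"
      using smooth_periodic_has_real_derivative(1)[OF smooth_periodic_component[OF sq]]
      by (intro DERIV_imp_deriv DERIV_cmult)
    \<comment> \<open>Positivity of \<open>\<epsilon>\<close> lets the weight
      \<open>\<epsilon>\<^sup>2\<close> of the functional cancel against the factor
      \<open>1 / \<epsilon>\<^sup>2\<close> of the operator.\<close>
    then show ?thesis
      using \<open>\<epsilon> > 0\<close> unfolding bbmh_J_var_deriv[OF I[OF q] \<open>a < b\<close>]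
      by (simp add: vec_eq_iff forall_3 bbmh_J_def
          smooth_periodic_vector_derivative_component[OF sq])
  qed
  then show ?thesis
    using I \<open>a < b\<close> variationally_differentiable_bbmh_J
    unfolding relative_equilibrium_structure_def by blast
qed

lemma hamiltonian_pde_bbmh:
  assumes "a < b"
  shows "hamiltonian_pde a b (bbmh \<epsilon>) (bbmh_J \<epsilon>) (bbmh_H \<epsilon> a b)"
proof -
  \<comment> \<open>Differentiation turns the nonlocal entries of the gradient back into local
    terms, so the potentials disappear from the right-hand side.\<close>
  have J_H: "bbmh_J \<epsilon> (var_deriv a b (bbmh_H \<epsilon> a b) q) x =
      - vector [q x $ 1 * deriv (\<lambda>y. q y $ 1) x + deriv (\<lambda>y. q y $ 2) x,
          1 / \<epsilon>\<^sup>2 * (deriv (\<lambda>y. q y $ 1) x - q x $ 3),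
          q x $ 2 + \<epsilon>\<^sup>2 * deriv (\<lambda>y. q y $ 3) x]"
    if q: "q \<in> phase_space a b" for q x
  proof -
    obtain psi chi where psi: "is_potential a b psi (\<lambda>x. q x $ 2)"
      and chi: "is_potential a b chi (\<lambda>x. q x $ 3)"
      using q by (auto simp: phase_space_def)
    have dq: "((\<lambda>y. q y $ i) has_real_derivative deriv (\<lambda>y. q y $ i) x) (at x)" for i
      using q by (auto simp: phase_space_def
          intro!: smooth_periodic_has_real_derivative smooth_periodic_component)
    have "deriv (\<lambda>y. (q y $ 1)\<^sup>2 / 2 + q y $ 2) x =
        q x $ 1 * deriv (\<lambda>y. q y $ 1) x + deriv (\<lambda>y. q y $ 2) x"
      by (intro DERIV_imp_deriv) (auto intro!: derivative_eq_intros dq)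
    moreover have "deriv (\<lambda>y. q y $ 1 - chi y) x = deriv (\<lambda>y. q y $ 1) x - q x $ 3"
      using chi by (intro DERIV_imp_deriv) (auto simp: is_potential_def intro!: derivative_eq_intros dq)
    moreover have "deriv (\<lambda>y. psi y + \<epsilon>\<^sup>2 * q y $ 3) x = q x $ 2 + \<epsilon>\<^sup>2 * deriv (\<lambda>y. q y $ 3) x"
      using psi by (intro DERIV_imp_deriv) (auto simp: is_potential_def intro!: derivative_eq_intros dq)
    ultimately show ?thesis
      unfolding bbmh_J_var_deriv[OF bbmh_H_variational_derivative[OF q psi chi \<open>a < b\<close>] \<open>a < b\<close>]
      by (simp add: bbmh_J_def)
  qed
  have "variationally_differentiable a b (bbmh_J \<epsilon>) (bbmh_H \<epsilon> a b)"
  proof (rule variationally_differentiable_bbmh_J)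
    fix q assume q: "q \<in> phase_space a b"
    then obtain psi chi where "is_potential a b psi (\<lambda>x. q x $ 2)"
      "is_potential a b chi (\<lambda>x. q x $ 3)"
      by (auto simp: phase_space_def)
    from bbmh_H_variational_derivative[OF q this \<open>a < b\<close>]
    show "\<exists>g. has_variational_derivative a b (bbmh_H \<epsilon> a b) q g"
      by blast
  qed (fact \<open>a < b\<close>)
  moreover have "bbmh \<epsilon> T q \<longleftrightarrow> (\<forall>t\<in>T. \<forall>x. vector_derivative (\<lambda>s. q s x) (at t) =
      bbmh_J \<epsilon> (var_deriv a b (bbmh_H \<epsilon> a b) (q t)) x)"
    if "smooth_evolution a b T q" for T q
    unfolding bbmh_def
  proof (intro ball_cong refl all_cong1)
    fix t x assume "t \<in> T"
    with that have qt: "q t \<in> phase_space a b"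
      by (simp add: smooth_evolution_def)
    \<comment> \<open>Joint smoothness, composed with the line of constant \<open>x\<close>, gives
      differentiability in \<open>t\<close>; this identifies the entries of the vector derivative
      with the scalar time derivatives.\<close>
    have "Ck_on (Suc 0) (T \<times> UNIV) (\<lambda>(t, x). q t x)"
      using that unfolding smooth_evolution_def smooth_on_def by blast
    then obtain D where D: "((\<lambda>(t, x). q t x) has_derivative D) (at (t, x))"
      using \<open>t \<in> T\<close> by auto
    have "((\<lambda>s. (s, x)) has_derivative (\<lambda>h. (h, 0))) (at t)"
      by (auto intro!: derivative_eq_intros)
    from has_derivative_compose[OF this D]
    have "((\<lambda>s. q s x) has_vector_derivative vector_derivative (\<lambda>s. q s x) (at t)) (at t)"
      by (auto simp: differentiable_def simp flip: vector_derivative_works)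
    from deriv_component[OF this]
    have dt: "vector_derivative (\<lambda>s. q s x) (at t) $ i = deriv (\<lambda>s. q s x $ i) t" for i
      by simp
    show "deriv (\<lambda>s. q s x $ 1) t + q t x $ 1 * deriv (\<lambda>y. q t y $ 1) x + deriv (\<lambda>y. q t y $ 2) x = 0 \<and>
        deriv (\<lambda>s. q s x $ 2) t + 1 / \<epsilon>\<^sup>2 * deriv (\<lambda>y. q t y $ 1) x = 1 / \<epsilon>\<^sup>2 * q t x $ 3 \<and>
        deriv (\<lambda>s. q s x $ 3) t + \<epsilon>\<^sup>2 * deriv (\<lambda>y. q t y $ 3) x = - (q t x $ 2) \<longleftrightarrow>
        vector_derivative (\<lambda>s. q s x) (at t) =
          bbmh_J \<epsilon> (var_deriv a b (bbmh_H \<epsilon> a b) (q t)) x"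
      \<comment> \<open>With \<open>1 / \<epsilon>\<^sup>2\<close> distributed, each equation of the
        system is a linear rearrangement of one component of the vector equation.\<close>
      unfolding J_H[OF qt] vec_eq_iff forall_3 dt right_diff_distrib
      by (simp, linarith)
  qed
  ultimately show ?thesis
    using constant_coefficient_bbmh_J skew_symmetric_bbmh_J \<open>a < b\<close>
    by (auto simp: hamiltonian_pde_def)
qed

text \<open>The first conjunct ensures that the arbitrary choice of a potential in
  \<open>bbmh_H\<close> does not affect the Hamiltonian.\<close>

theorem theorem2p1:
  fixes \<epsilon> xmin xmax :: real
  assumes "\<epsilon> > 0" and "xmin < xmax"
  shows "(\<forall>q\<in>phase_space xmin xmax. \<forall>chi. is_potential xmin xmax chi (\<lambda>x. q x $ 3) \<longrightarrow>
            bbmh_H \<epsilon> xmin xmax q = bbmh_H_with \<epsilon> xmin xmax chi q)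
       \<and> hamiltonian_pde xmin xmax (bbmh \<epsilon>) (bbmh_J \<epsilon>) (bbmh_H \<epsilon> xmin xmax)
       \<and> relative_equilibrium_structure xmin xmax (bbmh_J \<epsilon>) (bbmh_I \<epsilon> xmin xmax)"
  using assms bbmh_H_eq hamiltonian_pde_bbmh relative_equilibrium_structure_bbmh
  by (auto intro: less_imp_le)

end
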